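(* Let $R=(r_0,r_1,r_2)$ be the initial positions of three robots in general position in the plane and let $P=(p_0,p_1,p_2)$ be a triangular pattern with perimeter $1$. Let $Q=(q_0,q_1,q_2)$ be the positions the robots move to after running the following algorithm: for each $i\in\{0,1,2\}$ (indices modulo $3$), let $t_i$ be the point such that $\angle t_i r_{i+1} r_{i-1}=\angle p_i p_{i+1}p_{i-1}$ and $\angle r_{i+1}r_{i-1}t_i=\angle p_{i+1}p_{i-1}p_i$; robot $i$ moves from $r_i$ a distance $r= d(r_i,t_i)\,d(p_{i+1},p_{i-1})$ along the straight line toward $t_i$, ending at $q_i$. Then $Q$ is a valid solution, i.e. $Q$ is similar to $P$.
   Context: $d(\cdot,\cdot)$ is Euclidean distance. A triangular pattern is a sequence of three distinct points. Two sequences $P,Q$ of points are similar if some translation, rotation, uniform scaling, and/or reflection of some permutation of $P$ equals $Q$ entry by entry. The angles in the algorithm are directed, i.e. $t_i$ is the unique point such that the triple $(t_i,r_{i+1},r_{i-1})$ is obtained from $(p_i,p_{i+1},p_{i-1})$ by a translation, rotation, and/or uniform scaling (no reflection).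
   Formalization: "General position" is taken as: R is not collinear and is not an orientation-reversing similar copy of the triple of unit edge directions of P; for exactly those excluded non-collinear R (e.g. P, R equilateral of opposite orientation) all robots meet at one point and the claim fails. *)

theory Defs
  imports "HOL-Analysis.Analysis"
begin

text \<open>The plane is \<^typ>\<open>complex\<close>. A sequence of three points is a function on the three-element
  type \<^typ>\<open>3\<close>, whose arithmetic is modulo 3; its elements are 0, 1 and 2, and 3 = 0.\<close>

type_synonym points = "3 \<Rightarrow> complex"

definition direct_similar :: "points \<Rightarrow> points \<Rightarrow> bool" where
  "direct_similar P Q \<longleftrightarrow>
     (\<exists>c \<theta> b. c > 0 \<and> (\<forall>i. Q i = c *\<^sub>R (cis \<theta> * P i) + b))"

text \<open>Every reflection is the complex conjugation followed by a rotation and a translation.\<close>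

definition similar :: "points \<Rightarrow> points \<Rightarrow> bool" where
  "similar P Q \<longleftrightarrow>
     (\<exists>\<sigma>. bij \<sigma> \<and> (direct_similar (P \<circ> \<sigma>) Q \<or> direct_similar (cnj \<circ> P \<circ> \<sigma>) Q))"

definition triangular_pattern :: "points \<Rightarrow> bool" where
  "triangular_pattern P \<longleftrightarrow> inj P"

definition perimeter :: "points \<Rightarrow> real" where
  "perimeter P = (\<Sum>i\<in>UNIV. dist (P i) (P (i + 1)))"

text \<open>Since \<open>i\<close>, \<open>i + 1\<close> and \<open>i - 1\<close> are all the indices, \<open>R(i := t)\<close> is the triple of
  \<open>t\<close>, \<open>R (i + 1)\<close> and \<open>R (i - 1)\<close>, matched with \<open>P i\<close>, \<open>P (i + 1)\<close> and \<open>P (i - 1)\<close>.\<close>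

definition target :: "points \<Rightarrow> points \<Rightarrow> 3 \<Rightarrow> complex" where
  "target P R i = (THE t. direct_similar P (R(i := t)))"

text \<open>If the robot is already at its target, the distance to move is 0 (and \<open>sgn 0 = 0\<close>).\<close>

definition move :: "points \<Rightarrow> points \<Rightarrow> points" where
  "move P R i = R i +
     (dist (R i) (target P R i) * dist (P (i + 1)) (P (i - 1))) *\<^sub>R sgn (target P R i - R i)"

text \<open>For a pattern of perimeter 1 and non-collinear \<open>R\<close>, the three robots all move to one and
  the same point exactly if \<open>R\<close> is an orientation-reversing similar copy of the triangle of the
  three unit edge directions of \<open>P\<close>. (For an equilateral \<open>P\<close>, these are the equilateral triangles
  of the opposite orientation.) A single point is not similar to three distinct ones, so general
  position has to exclude this one similarity class besides the collinear configurations.\<close>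

definition edge_direction :: "points \<Rightarrow> points" where
  "edge_direction P i = sgn (P (i - 1) - P (i + 1))"

definition general_position :: "points \<Rightarrow> points \<Rightarrow> bool" where
  "general_position P R \<longleftrightarrow>
     \<not> collinear (range R) \<and> \<not> direct_similar (cnj \<circ> edge_direction P) R"

end

theory Submission
  imports Defs
begin

text \<open>Write \<open>e i = P (i - 1) - P (i + 1)\<close> and \<open>S = (\<Sum>j. e j * R j)\<close>. Then \<open>target P R i - R i = - S / e i\<close>,
  so with \<open>u i = sgn (e i)\<close> robot \<open>i\<close> moves to \<open>Q i = R i - cnj (u i) * S\<close>. Since
  \<open>e i * cnj (u i) = \<bar>e i\<bar>\<close> and the perimeter is 1, \<open>(\<Sum>i. e i * Q i) = 0\<close>, which forces
  \<open>Q i = a * P i + b\<close>. The case \<open>a = 0\<close>, where all robots meet, gives \<open>R i = S * cnj (u i) + b\<close>, which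
  general position excludes.\<close>

text \<open>Polar form: the modulus of \<open>a\<close> is the scaling and its argument the
  rotation. Hence similarity questions become linear algebra over the complex numbers.\<close>

lemma direct_similar_iff_affine:
  "direct_similar P Q \<longleftrightarrow> (\<exists>a b. a \<noteq> 0 \<and> (\<forall>i. Q i = a * P i + b))"
proof
  assume "direct_similar P Q"
  then obtain c \<theta> b where "c > 0" "\<forall>i. Q i = c *\<^sub>R (cis \<theta> * P i) + b"
    unfolding direct_similar_def by blast
  then show "\<exists>a b. a \<noteq> 0 \<and> (\<forall>i. Q i = a * P i + b)"
    by (intro exI[of _ "of_real c * cis \<theta>"] exI[of _ b]) (auto simp: scaleR_conv_of_real mult.assoc)
next
  assume "\<exists>a b. a \<noteq> 0 \<and> (\<forall>i. Q i = a * P i + b)"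
  then obtain a b where ab: "a \<noteq> 0" "\<forall>i. Q i = a * P i + b"
    by blast
  have "a = of_real (norm a) * cis (Arg a)"
    by (metis rcis_cmod_Arg rcis_def)
  then have "Q i = norm a *\<^sub>R (cis (Arg a) * P i) + b" for i
    using ab(2) by (metis mult.assoc scaleR_conv_of_real)
  with ab(1) show "direct_similar P Q"
    unfolding direct_similar_def by (metis zero_less_norm_iff)
qed

lemma type_3_numerals:
  "(3::3) = 0" "(4::3) = 1" "(- 1::3) = 2" "(- 2::3) = 1"
proof -
  show 3: "(3::3) = 0"
    by simp
  show "(4::3) = 1"
    using 3 by (metis add_0 numeral_plus_one semiring_norm(2,8))
  show "(- 1::3) = 2" "(- 2::3) = 1"
    using 3 by (simp_all add: neg_eq_iff_add_eq_0)
qed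

text \<open>Listing the indices from an arbitrary \<open>i\<close> lets a vertex be treated together
  with its two neighbours, without fixing which vertex it is.\<close>

lemma all_3_shift: "(\<forall>j::3. A j) \<longleftrightarrow> A i \<and> A (i + 1) \<and> A (i - 1)"
  using exhaust_3[of i] by (auto simp: forall_3 type_3_numerals)

lemma sum_3_shift:
  fixes f :: "3 \<Rightarrow> 'a :: comm_monoid_add"
  shows "sum f UNIV = f i + f (i + 1) + f (i - 1)"
  using exhaust_3[of i] by (auto simp: sum_3 type_3_numerals add_ac)

lemma shift_3_distinct:
  fixes i :: 3
  shows "i + 1 \<noteq> i" "i - 1 \<noteq> i" "i + 1 \<noteq> i - 1" "i + 1 + 1 = i - 1" "i - 1 - 1 = i + 1"
  using exhaust_3[of i] by auto

text \<open>\<open>edge_direction\<close> before normalisation. Being cyclic differences, the three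
  edges sum to 0.\<close>

definition opposite_edge :: "points \<Rightarrow> points" where
  "opposite_edge P i = P (i - 1) - P (i + 1)"

lemma opposite_edge_nonzero: "inj P \<Longrightarrow> opposite_edge P i \<noteq> 0"
  unfolding opposite_edge_def using shift_3_distinct(3)[of i] by (auto dest: injD)

text \<open>Two point pairs determine a complex affine map, so the target is the image of
  \<open>P i\<close> under the map fixed by the two neighbours. Over the denominator
  \<open>opposite_edge P i\<close>, the numerator is cyclically symmetric and so the same for all
  three robots.\<close>

lemma target_diff:
  assumes P: "inj P" and R: "inj R"
  shows "target P R i - R i = - (\<Sum>j\<in>UNIV. opposite_edge P j * R j) / opposite_edge P i"
proof -
  define p p' p'' where p_defs: "p = P i" "p' = P (i + 1)" "p'' = P (i - 1)"
  define r r' r'' where r_defs: "r = R i" "r' = R (i + 1)" "r'' = R (i - 1)"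
  have p: "p'' - p' \<noteq> 0" and r: "r'' - r' \<noteq> 0"
    using P R shift_3_distinct(3)[of i] unfolding p_defs r_defs by (auto dest: injD)
  \<comment> \<open>The value at \<open>p\<close> of the only affine map with p' to r' and p'' to
    r''.\<close>
  define t where "t = r' + (r'' - r') / (p'' - p') * (p - p')"
  have iff: "direct_similar P (R(i := s)) \<longleftrightarrow>
      (\<exists>a b. a \<noteq> 0 \<and> s = a * p + b \<and> r' = a * p' + b \<and> r'' = a * p'' + b)" for s
    unfolding direct_similar_iff_affine all_3_shift[where i = i] p_defs r_defs
    by (simp add: shift_3_distinct)
  have "direct_similar P (R(i := s)) \<longleftrightarrow> s = t" for s
  proof
    assume "direct_similar P (R(i := s))"
    then obtain a b where ab: "s = a * p + b" "r' = a * p' + b" "r'' = a * p'' + b"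
      unfolding iff by blast
    have "r'' - r' = a * (p'' - p')"
      unfolding ab by (simp add: algebra_simps)
    then have "(r'' - r') / (p'' - p') = a"
      using p by simp
    then show "s = t"
      unfolding t_def by (simp add: ab(1) ab(2) algebra_simps)
  next
    assume "s = t"
    define a where "a = (r'' - r') / (p'' - p')"
    have a: "a * (p'' - p') = r'' - r'"
      using p unfolding a_def by simp
    have "a \<noteq> 0"
      using p r unfolding a_def by simp
    moreover have "s = a * p + (r' - a * p')"
      unfolding \<open>s = t\<close> t_def a_def[symmetric] by (simp add: algebra_simps)
    moreover have "r'' = a * p'' + (r' - a * p')"
      using a by (simp add: algebra_simps)
    ultimately show "direct_similar P (R(i := s))"
      unfolding iff by (metis add.commute diff_add_cancel)
  qed
  then have "target P R i = t"
    unfolding target_def by simp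
  moreover have "opposite_edge P i = p'' - p'"
    unfolding opposite_edge_def p_defs ..
  moreover have "(\<Sum>j\<in>UNIV. opposite_edge P j * R j)
      = (p'' - p') * r + (p - p'') * r' + (p' - p) * r''"
    unfolding sum_3_shift[where i = i] opposite_edge_def p_defs r_defs
    by (simp add: shift_3_distinct)
  moreover have "t - r = - ((p'' - p') * r + (p - p'') * r' + (p' - p) * r'') / (p'' - p')"
    unfolding t_def using p by (simp add: field_simps)
  ultimately show ?thesis
    by (simp add: r_defs)
qed

text \<open>The prescribed distance scales the vector to the target by the length of
  \<open>e\<close>, and dividing that length by \<open>e\<close> leaves the unit number
  \<open>cnj (sgn e)\<close>.\<close>

lemma move_eq:
  assumes "inj P" and "inj R"
  shows "move P R i
    = R i - cnj (edge_direction P i) * (\<Sum>j\<in>UNIV. opposite_edge P j * R j)"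
proof -
  define e where "e = opposite_edge P i"
  have "e \<noteq> 0"
    unfolding e_def by (rule opposite_edge_nonzero[OF assms(1)])
  have "move P R i = R i + norm e *\<^sub>R (target P R i - R i)"
    \<comment> \<open>Distance times \<open>sgn\<close> gives back the difference vector; at the
      target both sides are 0.\<close>
    by (cases "target P R i = R i")
      (simp_all add: move_def e_def opposite_edge_def dist_norm sgn_div_norm norm_minus_commute)
  moreover have "of_real (norm e) / e = cnj (sgn e)"
    using \<open>e \<noteq> 0\<close> complex_norm_square[of e]
    by (simp add: sgn_eq field_simps power2_eq_square)
  moreover have "edge_direction P i = sgn e"
    unfolding edge_direction_def e_def opposite_edge_def ..
  ultimately show ?thesis
    unfolding target_diff[OF assms] e_def[symmetric]
    by (simp add: scaleR_conv_of_real) (metis times_divide_eq_left)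
qed

lemma sum_opposite_edge_move:
  assumes "inj P" and "inj R" and "perimeter P = 1"
  shows "(\<Sum>i\<in>UNIV. opposite_edge P i * move P R i) = 0"
proof -
  define S where "S = (\<Sum>j\<in>UNIV. opposite_edge P j * R j)"
  have "opposite_edge P i * cnj (edge_direction P i) = of_real (norm (opposite_edge P i))" for i
    using complex_norm_square[of "opposite_edge P i"]
    by (simp add: edge_direction_def opposite_edge_def sgn_eq power2_eq_square divide_simps)
  then have "(\<Sum>i\<in>UNIV. opposite_edge P i * move P R i)
      = S - of_real (\<Sum>i\<in>UNIV. norm (opposite_edge P i)) * S"
    unfolding move_eq[OF assms(1,2)] S_def[symmetric] right_diff_distrib
    by (simp add: sum_subtractf S_def[symmetric] mult.assoc[symmetric] sum_distrib_right)
  \<comment> \<open>The same three side lengths, indexed by the opposite vertex instead of the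
    starting vertex.\<close>
  also have "(\<Sum>i\<in>UNIV. norm (opposite_edge P i)) = perimeter P"
    unfolding perimeter_def opposite_edge_def
    by (simp add: sum_3_shift[where i = 0] type_3_numerals dist_norm norm_minus_commute)
  finally show ?thesis
    using assms(3) by simp
qed

text \<open>The hypothesis is one nontrivial linear equation in \<open>Q\<close>. Its solution space
  has dimension 2 and is spanned by \<open>P\<close> and the constant sequence.\<close>

lemma affine_if_sum_opposite_edge_eq_0:
  assumes "inj P" and "(\<Sum>i\<in>UNIV. opposite_edge P i * Q i) = 0"
  shows "\<exists>a b. \<forall>i. Q i = a * P i + b"
proof -
  define a where "a = (Q 2 - Q 1) / (P 2 - P 1)"
  have "P 2 - P 1 \<noteq> 0"
    using assms(1) by (auto dest: injD)
  then have a: "a * (P 2 - P 1) = Q 2 - Q 1"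
    unfolding a_def by simp
  have "(P 2 - P 1) * Q 0 + (P 0 - P 2) * Q 1 + (P 1 - P 0) * Q 2 = 0"
    using assms(2) unfolding sum_3_shift[where i = 0] opposite_edge_def
    by (simp add: type_3_numerals)
  \<comment> \<open>Since the edges sum to 0, \<open>Q 1\<close> may be subtracted from every
    \<open>Q i\<close>.\<close>
  then have "(P 2 - P 1) * (Q 0 - Q 1) = (P 0 - P 1) * (Q 2 - Q 1)"
    by (simp add: algebra_simps)
  also have "\<dots> = (P 2 - P 1) * (a * (P 0 - P 1))"
    unfolding a[symmetric] by simp
  finally have "Q 0 - Q 1 = a * (P 0 - P 1)"
    using \<open>P 2 - P 1 \<noteq> 0\<close> by simp
  with a have "\<forall>i. Q i = a * P i + (Q 1 - a * P 1)"
    unfolding forall_3 type_3_numerals by (simp add: algebra_simps)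
  then show ?thesis
    by blast
qed

lemma noncollinear_inj:
  fixes R :: points
  assumes "\<not> collinear (range R)"
  shows "inj R"
proof (rule ccontr)
  assume "\<not> inj R"
  then have "R 1 = R 2 \<or> R 1 = R 3 \<or> R 2 = R 3"
    unfolding inj_def forall_3 by auto
  then have "\<exists>x y. range R = {x, y}"
    unfolding UNIV_3 by auto
  with assms show False
    by auto
qed

theorem theorem5:
  fixes P R Q :: "3 \<Rightarrow> complex"
  assumes "triangular_pattern P"
    and "perimeter P = 1"
    and "general_position P R"
    and "Q = move P R"
  shows "similar P Q"
proof -
  have P: "inj P" and ncol: "\<not> collinear (range R)"
    and nsim: "\<not> direct_similar (cnj \<circ> edge_direction P) R"
    using assms unfolding triangular_pattern_def general_position_def by auto
  have R: "inj R"
    using ncol by (rule noncollinear_inj)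
  obtain a b where ab: "\<forall>i. Q i = a * P i + b"
    using affine_if_sum_opposite_edge_eq_0[OF P sum_opposite_edge_move[OF P R assms(2)]]
    unfolding assms(4) by blast
  have "a \<noteq> 0"
  proof
    assume "a = 0"
    define S where "S = (\<Sum>j\<in>UNIV. opposite_edge P j * R j)"
    have eq: "R i = S * cnj (edge_direction P i) + b" for i
      using ab \<open>a = 0\<close> move_eq[OF P R, of i] unfolding assms(4) S_def[symmetric]
      by (simp add: algebra_simps)
    \<comment> \<open>For \<open>S = 0\<close>, \<open>eq\<close> would make \<open>R\<close>
      constant. So \<open>S\<close> can serve as the nonzero factor of the excluded
      similarity.\<close>
    have "S \<noteq> 0"
      using eq[of 0] eq[of 1] injD[OF R, of 0 1] by auto
    with eq nsim show False
      unfolding direct_similar_iff_affine by auto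
  qed
  \<comment> \<open>The robots form the pattern with its own labelling and orientation.\<close>
  with ab have "direct_similar (P \<circ> id) Q"
    unfolding direct_similar_iff_affine by auto
  then show ?thesis
    unfolding similar_def using bij_id by blast
qed

end
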